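(* Let $n, r \geq 1$ and $\ell \in \mathbb{Z}$. If $\mathcal{S}_{(r,n)}(\ell) \in \mathbb{Z}$, then there exist positive integers $a$ and $b$ such that $\mathcal{S}_{(r,n)}(a + b \lambda) \in \mathbb{Z}$ for all $\lambda \in \mathbb{Z}$, where $b = \binom{r+n}{r}$ and $1 < a < b$ with $a \equiv \ell \pmod{b}$. As a consequence, if $\mathcal{S}_{(r,n)}(\ell) \notin \mathbb{Z}$ for all integers $1 < \ell < b$, then $\mathcal{S}_{(r,n)}(\ell) \notin \mathbb{Z}$ for all $\ell \in \mathbb{Z}$.
   Context: For integers $n, r \geq 0$, $\mathcal{S}_{(r,n)}(x) = \sum_{k=0}^{n} \binom{n}{k} (-1)^k x^{n-k} \binom{r+k}{r}^{-1} \in \mathbb{Q}[x]$. *)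

theory Defs
  imports
    "HOL-Computational_Algebra.Polynomial"
    "HOL-Number_Theory.Cong"
begin

definition S_poly :: "nat \<Rightarrow> nat \<Rightarrow> rat poly" where
  "S_poly r n =
     (\<Sum>k=0..n. monom (of_nat (n choose k) * (-1) ^ k * inverse (of_nat ((r + k) choose r))) (n - k))"

end

theory Submission
  imports Defs
begin

text \<open>
  Put \<open>b = binom(r+n, r)\<close>. Since \<open>b \<cdot> binom(n, k) / binom(r+k, r) = binom(r+n, n-k)\<close>, the number
  \<open>b S(x)\<close> is, up to sign, the truncation at degree \<open>n\<close> of the expansion of \<open>(1-x) ^ (r+n)\<close>. So
  \<open>S(l)\<close> is an integer iff \<open>b\<close> divides this truncation at \<open>l\<close>, which depends only on \<open>l mod b\<close>.
  The residues 0 and 1 never occur: the truncation is 1 at 0, and up to sign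
  \<open>binom(r+n-1, n)\<close> at 1, which lies strictly between 0 and \<open>b\<close> by Pascal's rule.
\<close>

definition binomial_truncation :: "nat \<Rightarrow> nat \<Rightarrow> int \<Rightarrow> int" where
  "binomial_truncation r n x = (\<Sum>j\<le>n. int ((r + n) choose j) * (- x) ^ j)"

text \<open>Both sides count the pairs of an r-subset inside an (r+k)-subset of an (r+n)-set. This
  clears the denominators of \<open>S_poly\<close> after multiplication by
  \<open>(r + n) choose r\<close>.\<close>

lemma choose_mult_choose_add:
  fixes r n k :: nat
  assumes "k \<le> n"
  shows "((r + n) choose r) * (n choose k) = ((r + n) choose (n - k)) * ((r + k) choose r)"
proof -
  have "((r + n) choose (r + k)) * ((r + k) choose r) = ((r + n) choose r) * (n choose k)"
    using choose_mult[of r "r + k" "r + n"] assms by simp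
  moreover have "(r + n) choose (r + k) = (r + n) choose (n - k)"
    using binomial_symmetric[of "r + k" "r + n"] assms by simp
  ultimately show ?thesis by simp
qed

lemma poly_S_poly:
  "of_nat ((r + n) choose r) * poly (S_poly r n) (of_int l)
     = of_int ((- 1) ^ n * binomial_truncation r n l)"
proof -
  have "of_nat ((r + n) choose r) * poly (S_poly r n) (of_int l) =
      (\<Sum>k\<le>n. of_nat ((r + n) choose r) *
        (of_nat (n choose k) * (- 1) ^ k * inverse (of_nat ((r + k) choose r)) * of_int l ^ (n - k)))"
    by (simp add: S_poly_def poly_sum poly_monom sum_distrib_left atLeast0AtMost)
  also have "\<dots> = (\<Sum>k\<le>n. (- 1) ^ k * of_nat ((r + n) choose (n - k)) * of_int l ^ (n - k))"
  proof (rule sum.cong)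
    fix k assume "k \<in> {..n}"
    then have "of_nat ((r + n) choose r) * of_nat (n choose k)
        = (of_nat ((r + n) choose (n - k)) * of_nat ((r + k) choose r) :: rat)"
      using choose_mult_choose_add[of k n r] by (metis atMost_iff of_nat_mult)
    moreover have "(of_nat ((r + k) choose r) :: rat) \<noteq> 0"
      by simp
    ultimately show "of_nat ((r + n) choose r) *
        (of_nat (n choose k) * (- 1) ^ k * inverse (of_nat ((r + k) choose r)) * of_int l ^ (n - k))
        = (- 1) ^ k * of_nat ((r + n) choose (n - k)) * (of_int l ^ (n - k) :: rat)"
      by (simp add: field_simps)
  qed simp
  also have "\<dots> = (\<Sum>j\<le>n. (- 1) ^ (n - j) * of_nat ((r + n) choose j) * of_int l ^ j)"
    by (rule sum.reindex_bij_witness[of _ "\<lambda>j. n - j" "\<lambda>j. n - j"]) auto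
  also have "\<dots> = of_int ((- 1) ^ n * binomial_truncation r n l)"
    unfolding binomial_truncation_def of_int_mult of_int_sum sum_distrib_left
  proof (rule sum.cong)
    fix j assume "j \<in> {..n}"
    \<comment> \<open>Since j \<le> n, the natural subtraction is exact, so n - j and n + j have the
      same parity.\<close>
    then have "(- 1) ^ (n - j) = (- 1) ^ n * ((- 1) ^ j :: rat)"
      by (auto simp: minus_one_power_iff)
    moreover have "of_int ((- l) ^ j) = ((- 1) ^ j * of_int l ^ j :: rat)"
      by (metis of_int_minus of_int_power power_minus)
    ultimately show "(- 1) ^ (n - j) * of_nat ((r + n) choose j) * of_int l ^ j =
        of_int ((- 1) ^ n) * (of_int (int ((r + n) choose j)) * (of_int ((- l) ^ j) :: rat))"
      by simp
  qed simp
  finally show ?thesis .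
qed

lemma poly_S_poly_in_Ints_iff:
  "poly (S_poly r n) (of_int l) \<in> \<int> \<longleftrightarrow> int ((r + n) choose r) dvd binomial_truncation r n l"
proof -
  let ?b = "int ((r + n) choose r)" and ?T = "(- 1) ^ n * binomial_truncation r n l"
  \<comment> \<open>With z left arbitrary, the witness of integrality and the quotient in the
    divisibility are the same integer; cancelling \<open>?b\<close> is sound because it is
    nonzero.\<close>
  have "poly (S_poly r n) (of_int l) = of_int z \<longleftrightarrow> ?T = ?b * z" for z
  proof -
    have "poly (S_poly r n) (of_int l) = of_int z \<longleftrightarrow>
        of_nat ((r + n) choose r) * poly (S_poly r n) (of_int l) = of_int (?b * z)"
      by simp
    also have "\<dots> \<longleftrightarrow> ?T = ?b * z"
      unfolding poly_S_poly by (simp only: of_int_eq_iff)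
    finally show ?thesis .
  qed
  then have "poly (S_poly r n) (of_int l) \<in> \<int> \<longleftrightarrow> ?b dvd ?T"
    by (auto simp: Ints_def dvd_def image_iff)
  also have "\<dots> \<longleftrightarrow> ?b dvd binomial_truncation r n l"
    by (cases "even n") simp_all
  finally show ?thesis .
qed

lemma cong_binomial_truncation:
  "[x = y] (mod m) \<Longrightarrow> [binomial_truncation r n x = binomial_truncation r n y] (mod m)"
  unfolding binomial_truncation_def
  by (intro cong_sum cong_mult cong_refl cong_pow) (simp add: cong_minus_minus_iff)

lemma binomial_truncation_0: "binomial_truncation r n 0 = 1"
  by (simp add: binomial_truncation_def power_0_left if_distrib sum.delta cong: if_cong)

text \<open>By Pascal's rule each binomial splits into two neighbours in row m, and the alternating
  signs make the sum telescope.\<close>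

lemma sum_choose_alternating:
  "(\<Sum>j\<le>n. int (Suc m choose j) * (- 1) ^ j) = (- 1) ^ n * int (m choose n)"
  by (induction n) (simp_all add: algebra_simps)

lemma binomial_truncation_1:
  assumes "r \<ge> 1"
  shows "binomial_truncation r n 1 = (- 1) ^ n * int ((r + n - 1) choose n)"
  using sum_choose_alternating[of "r + n - 1" n] assms by (simp add: binomial_truncation_def)

lemma pred_choose_pos: "r \<ge> 1 \<Longrightarrow> 0 < (r + n - 1) choose n" for r n :: nat
  by simp

text \<open>The inequality is strict because the other summand in Pascal's rule,
  \<open>(r + n - 1) choose (n - 1)\<close>, is positive.\<close>

lemma pred_choose_less:
  fixes r n :: nat
  assumes "n \<ge> 1" "r \<ge> 1"
  shows "(r + n - 1) choose n < (r + n) choose r"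
proof -
  obtain s m where rn: "r = Suc s" "n = Suc m"
    using assms by (metis Suc_le_D One_nat_def)
  have "(r + n) choose r = (r + n) choose n"
    using binomial_symmetric[of r "r + n"] by simp
  also have "\<dots> = ((r + n - 1) choose (n - 1)) + ((r + n - 1) choose n)"
    by (simp add: rn)
  finally show ?thesis
    by (simp add: rn)
qed

lemma not_dvd_binomial_truncation_0:
  assumes "n \<ge> 1" "r \<ge> 1"
  shows "\<not> int ((r + n) choose r) dvd binomial_truncation r n 0"
proof -
  \<comment> \<open>A positive integer lies strictly below this binomial, so it is at least 2 and
    cannot divide 1.\<close>
  have "(r + n) choose r \<noteq> 1"
    using pred_choose_less[OF assms] pred_choose_pos[OF assms(2), of n] by linarith
  then show ?thesis by (simp add: binomial_truncation_0)
qed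

lemma not_dvd_binomial_truncation_1:
  assumes "n \<ge> 1" "r \<ge> 1"
  shows "\<not> int ((r + n) choose r) dvd binomial_truncation r n 1"
proof -
  have "\<not> (r + n) choose r dvd (r + n - 1) choose n"
    using pred_choose_less[OF assms] pred_choose_pos[OF assms(2), of n] nat_dvd_not_less by blast
  then show ?thesis
    using assms by (cases "even n") (simp_all add: binomial_truncation_1)
qed

lemma S_poly_integral_residue:
  fixes n r :: nat and l :: int
  defines "b \<equiv> int ((r + n) choose r)"
  assumes "n \<ge> 1" "r \<ge> 1" and l: "poly (S_poly r n) (of_int l) \<in> \<int>"
  shows "1 < l mod b" "l mod b < b"
    and "\<And>m. poly (S_poly r n) (of_int (l mod b + b * m)) \<in> \<int>"
proof -
  have b: "b > 0"
    by (simp add: b_def)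
  have eq: "poly (S_poly r n) (of_int x) \<in> \<int> \<longleftrightarrow> b dvd binomial_truncation r n x" for x
    by (simp add: poly_S_poly_in_Ints_iff b_def)
  \<comment> \<open>Divisibility by b passes along the whole residue class of l: this yields both
    the integrality on the progression and the exclusion of the residues 0 and 1.\<close>
  have int: "b dvd binomial_truncation r n x" if "[x = l] (mod b)" for x
    using l that eq cong_binomial_truncation cong_dvd_iff by blast
  show "poly (S_poly r n) (of_int (l mod b + b * m)) \<in> \<int>" for m
    unfolding eq by (rule int) (simp add: cong_def)
  have "b dvd binomial_truncation r n (l mod b)"
    by (rule int) (simp add: cong_def)
  then have "l mod b \<noteq> 0" "l mod b \<noteq> 1"
    using assms not_dvd_binomial_truncation_0 not_dvd_binomial_truncation_1 unfolding b_def by metis+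
  then show "1 < l mod b"
    using pos_mod_sign[OF b, of l] by linarith
  show "l mod b < b"
    using b by simp
qed

theorem theorem7p1:
  fixes n r :: nat
  assumes "n \<ge> 1" and "r \<ge> 1"
  shows
    "(\<forall>l::int. poly (S_poly r n) (of_int l) \<in> \<int> \<longrightarrow>
        (\<exists>a b::int. a > 0 \<and> b > 0 \<and> b = int ((r + n) choose r) \<and>
           1 < a \<and> a < b \<and> [a = l] (mod b) \<and>
           (\<forall>m::int. poly (S_poly r n) (of_int (a + b * m)) \<in> \<int>))) \<and>
     ((\<forall>l::int. 1 < l \<and> l < int ((r + n) choose r) \<longrightarrow> poly (S_poly r n) (of_int l) \<notin> \<int>) \<longrightarrow>
        (\<forall>l::int. poly (S_poly r n) (of_int l) \<notin> \<int>))"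
proof -
  define b where "b = int ((r + n) choose r)"
  note residue = S_poly_integral_residue[OF assms, folded b_def]
  have "\<exists>a b'. a > 0 \<and> b' > 0 \<and> b' = b \<and> 1 < a \<and> a < b' \<and> [a = l] (mod b') \<and>
      (\<forall>m. poly (S_poly r n) (of_int (a + b' * m)) \<in> \<int>)"
    if "poly (S_poly r n) (of_int l) \<in> \<int>" for l
    using residue[OF that] by (intro exI[of _ "l mod b"] exI[of _ b]) auto
  \<comment> \<open>The second claim by contraposition: any integral value forces one at the residue
    of l, which is the case m = 0 of the progression.\<close>
  moreover have "\<exists>a. 1 < a \<and> a < b \<and> poly (S_poly r n) (of_int a) \<in> \<int>"
    if "poly (S_poly r n) (of_int l) \<in> \<int>" for l
    using residue(1,2)[OF that] residue(3)[OF that, of 0] by auto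
  ultimately show ?thesis
    unfolding b_def by blast
qed

end
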